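(* Let $n\in\mathbb{N}$ and let $t$ be a real number with $|t|\leq 1$, $t\neq0$. Then $$ \begin{aligned} \sum_{k=1}^{\infty}\frac{t^k}{k^2\binom{n+k}{k}}={}&Li_2(t)-H_n^{(2)}+\log(1-t)\sum_{k=1}^{n}\frac{1}{k}\left(\frac{t-1}{t}\right)^k\\ &-\sum_{k=1}^{n}\frac{H_k+H_{n-k}-H_n}{k}\left(\frac{t-1}{t}\right)^k, \end{aligned} $$ where for $t=1$ the right-hand side is understood as its limit as $t\to1^-$.
   Context: $\mathbb{N}=\{1,2,3,\dots\}$. $H_m=\sum_{j=1}^m\frac1j$ and $H_m^{(2)}=\sum_{j=1}^m\frac1{j^2}$, with $H_0=0$. $Li_2(x)=\sum_{k\ge1}x^k/k^2$ for $|x|\le1$. Infinite series are limits of partial sums. *)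

theory Defs
  imports "HOL-Analysis.Analysis"
begin

text \<open>The harmonic numbers \<open>H\<^sub>m\<close> are the library's \<open>harm m\<close>.\<close>

definition harm2 :: "nat \<Rightarrow> real" where
  "harm2 m = (\<Sum>j=1..m. 1 / real j ^ 2)"

text \<open>Only meaningful for \<open>\<bar>x\<bar> \<le> 1\<close>, where the series converges. The library's series start at index 0,
  so the index is shifted: \<open>Suc k\<close> runs through the positive integers.\<close>

definition Li2 :: "real \<Rightarrow> real" where
  "Li2 x = (\<Sum>k. x ^ Suc k / real (Suc k) ^ 2)"

text \<open>The closed form, as an expression in \<open>t\<close>. At \<open>t = 1\<close> it contains \<open>ln 0\<close>, for which the library
  has a default value; the theorem uses the limit from the left there and never this value.\<close>

definition closed_form :: "nat \<Rightarrow> real \<Rightarrow> real" where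
  "closed_form n t =
     Li2 t - harm2 n
     + ln (1 - t) * (\<Sum>k=1..n. 1 / real k * ((t - 1) / t) ^ k)
     - (\<Sum>k=1..n. (harm k + harm (n - k) - harm n) / real k * ((t - 1) / t) ^ k)"

end

theory Submission
  imports Defs
begin

text \<open>
  Write \<open>S\<^sub>n(t)\<close> for the series in question, \<open>T\<^sub>n(t)\<close> for the same series with \<open>k\<close> in place of
  \<open>k\<^sup>2\<close> in the denominator, and \<open>D = (t - 1) / t\<close>. Two elementary identities between reciprocal
  binomial coefficients reduce everything to \<open>S\<^sub>0 = Li\<^sub>2(t)\<close> and \<open>T\<^sub>0 = - ln (1 - t)\<close>:

  \<^item> \<open>1 / C(n+1+k,k) = 1 / C(n+k,k) - k / ((n+1) C(n+1+k,k))\<close> gives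
    \<open>S\<^sub>n\<^sub>+\<^sub>1 = S\<^sub>n - T\<^sub>n\<^sub>+\<^sub>1 / (n+1)\<close>;

  \<^item> \<open>1 / (k C(n+1+k,k)) = 1 / (k C(n+k,k)) - 1 / ((k+1) C(n+k+1,k+1))\<close>, multiplied by \<open>t\<^sup>k\<close> and
    summed, gives \<open>T\<^sub>n\<^sub>+\<^sub>1 = 1 / (n+1) + D T\<^sub>n\<close>.

  The second recurrence is solved by \<open>T\<^sub>n = - D\<^sup>n ln (1 - t) + (\<Sum>k<n. D\<^sup>k / (n - k))\<close>
  (\<open>first_order_sums\<close>). The closed form obeys the first recurrence with this \<open>T\<^sub>n\<^sub>+\<^sub>1\<close>
  (\<open>closed_form_Suc\<close>): the harmonic numbers arise from summing
  \<open>1 / (m (m - k)) = (1 / (m - k) - 1 / m) / k\<close> over \<open>m\<close> from \<open>k + 1\<close> to \<open>n\<close>. This settles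
  \<open>-1 \<le> t < 1\<close>.

  At \<open>t = 1\<close> the series for \<open>T\<^sub>0\<close> diverges, so the second recurrence has no starting value. But the terms of
  \<open>S\<^sub>n\<close> are dominated by \<open>1 / k\<^sup>2\<close>, so \<open>S\<^sub>n\<close> is continuous on \<open>[-1, 1]\<close>, and its value at \<open>1\<close> is
  the left limit of the closed form.
\<close>

section \<open>Reciprocal binomial coefficients\<close>

lemma binomial_add_Suc_left:
  "real ((Suc n + k) choose k) = real (Suc (n + k)) * real ((n + k) choose k) / real (Suc n)"
proof -
  have "Suc n * ((Suc n + k) choose k) = Suc (n + k) * ((n + k) choose k)"
    using Suc_times_binomial_eq[of "n + k" n]
      binomial_symmetric[of n "n + k"] binomial_symmetric[of "Suc n" "Suc (n + k)"]
    by (simp add: mult.commute)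
  hence "real (Suc n) * real ((Suc n + k) choose k) = real (Suc (n + k)) * real ((n + k) choose k)"
    by (metis of_nat_mult)
  then show ?thesis by (simp add: field_simps del: of_nat_Suc)
qed

lemma reciprocal_binomial_step:
  "1 / (real (Suc k) * real ((Suc n + Suc k) choose Suc k)) =
   1 / (real (Suc k) * real ((n + Suc k) choose Suc k))
   - 1 / (real (Suc (Suc k)) * real ((n + Suc (Suc k)) choose Suc (Suc k)))"
proof -
  define C where "C = real ((n + Suc k) choose Suc k)"
  have C: "C > 0" unfolding C_def by (simp del: binomial_Suc_Suc)
  have "Suc (Suc k) * ((n + Suc (Suc k)) choose Suc (Suc k)) =
      Suc (n + Suc k) * ((n + Suc k) choose Suc k)"
    using Suc_times_binomial_eq[of "n + Suc k" "Suc k"] by (simp add: mult.commute)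
  hence 2: "real (Suc (Suc k)) * real ((n + Suc (Suc k)) choose Suc (Suc k)) =
      real (Suc (n + Suc k)) * C"
    unfolding C_def by (metis of_nat_mult)
  have 3: "real ((Suc n + Suc k) choose Suc k) = real (Suc (n + Suc k)) * C / real (Suc n)"
    unfolding C_def by (rule binomial_add_Suc_left)
  show ?thesis
    unfolding 2 3 C_def[symmetric] using C by (simp add: divide_simps)
qed

lemma reciprocal_binomial_step_square:
  "1 / (real (Suc k) ^ 2 * real ((Suc n + Suc k) choose Suc k)) =
   1 / (real (Suc k) ^ 2 * real ((n + Suc k) choose Suc k))
   - 1 / real (Suc n) * (1 / (real (Suc k) * real ((Suc n + Suc k) choose Suc k)))"
proof -
  define C where "C = real ((n + Suc k) choose Suc k)"
  have C: "C > 0" unfolding C_def by (simp del: binomial_Suc_Suc)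
  have 3: "real ((Suc n + Suc k) choose Suc k) = real (Suc (n + Suc k)) * C / real (Suc n)"
    unfolding C_def by (rule binomial_add_Suc_left)
  show ?thesis
    unfolding 3 C_def[symmetric] using C
    by (simp add: divide_simps power2_eq_square)
qed

section \<open>The series with a first power of the index\<close>

text \<open>For \<open>\<bar>t\<bar> < 1\<close> this is the power series of the logarithm; the boundary point \<open>-1\<close> is the
  alternating harmonic series.\<close>

lemma minus_ln_one_minus_sums:
  fixes t :: real
  assumes "-1 \<le> t" "t < 1"
  shows "(\<lambda>k. t ^ Suc k / real (Suc k)) sums (- ln (1 - t))"
proof (cases "t = -1")
  case True
  have "(\<lambda>k. - ((-1) ^ k / real (Suc k))) sums (- ln 2)"
    using alternating_harmonic_series_sums by (intro sums_minus) simp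
  then show ?thesis using True by simp
next
  case False
  hence "(\<lambda>k. - ((- (- t)) ^ k) / of_nat k) sums ln (1 + (- t))"
    using assms by (intro ln_series') simp
  hence "(\<lambda>k. - (- ((- (- t)) ^ k) / of_nat k)) sums (- ln (1 + (- t)))"
    by (rule sums_minus)
  hence "(\<lambda>k. t ^ k / real k) sums (- ln (1 - t))" by simp
  then show ?thesis by (subst sums_Suc_iff) simp
qed

lemma first_order_sums:
  fixes t :: real
  assumes t: "-1 \<le> t" "t < 1" "t \<noteq> 0"
  defines "D \<equiv> (t - 1) / t"
  shows "(\<lambda>k. t ^ Suc k / (real (Suc k) * real ((n + Suc k) choose Suc k))) sums
           (- (D ^ n) * ln (1 - t) + (\<Sum>k<n. D ^ k / real (n - k)))"
proof (induction n)
  case 0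
  then show ?case using minus_ln_one_minus_sums[OF t(1,2)] by simp
next
  case (Suc n)
  define b where "b = (\<lambda>k. 1 / (real (Suc k) * real ((n + Suc k) choose Suc k)))"
  define T where "T = - (D ^ n) * ln (1 - t) + (\<Sum>k<n. D ^ k / real (n - k))"
  have b0: "b 0 = 1 / real (Suc n)" unfolding b_def by simp
  have s: "(\<lambda>k. t ^ Suc k * b k) sums T"
    using Suc unfolding b_def T_def by simp
  \<comment> \<open>Shifting the index drops the term \<open>k = 1\<close>; dividing by \<open>t\<close> realigns the powers, which is
      where \<open>D = 1 - 1 / t\<close> comes from.\<close>
  have "(\<lambda>k. t ^ Suc (Suc k) * b (Suc k)) sums (T - t * b 0)"
    using s by (subst sums_Suc_iff) simp
  hence "(\<lambda>k. 1 / t * (t ^ Suc (Suc k) * b (Suc k))) sums (1 / t * (T - t * b 0))"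
    by (rule sums_mult)
  hence "(\<lambda>k. t ^ Suc k * b (Suc k)) sums (1 / t * (T - t * b 0))"
    using t(3) by (simp add: mult.assoc)
  from sums_diff[OF s this]
  have "(\<lambda>k. t ^ Suc k * (b k - b (Suc k))) sums (T - 1 / t * (T - t * b 0))"
    by (simp add: algebra_simps)
  moreover have "T - 1 / t * (T - t * b 0) = 1 / real (Suc n) + D * T"
    unfolding b0 D_def using t(3) by (simp add: diff_divide_distrib left_diff_distrib right_diff_distrib)
  moreover have "1 / real (Suc n) + D * T =
      - (D ^ Suc n) * ln (1 - t) + (\<Sum>k<Suc n. D ^ k / real (Suc n - k))"
    unfolding T_def
    by (subst sum.lessThan_Suc_shift) (simp add: algebra_simps sum_distrib_left)
  moreover have "t ^ Suc k * (b k - b (Suc k)) =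
      t ^ Suc k / (real (Suc k) * real ((Suc n + Suc k) choose Suc k))" for k
    unfolding b_def reciprocal_binomial_step[symmetric] by simp
  ultimately show ?case by simp
qed

section \<open>The closed form\<close>

lemma closed_form_Suc:
  fixes t :: real
  defines "D \<equiv> (t - 1) / t"
  shows "closed_form (Suc n) t = closed_form n t
    - 1 / real (Suc n) *
        (- (D ^ Suc n) * ln (1 - t) + (\<Sum>k<Suc n. D ^ k / real (Suc n - k)))"
proof -
  define c where "c = (\<lambda>n k. (harm k + harm (n - k) - harm n) / real k * D ^ k)"
  have "(\<Sum>k=1..Suc n. c (Suc n) k) = (\<Sum>k=1..n. c (Suc n) k)"
    unfolding c_def by (simp add: harm_def)
  also have "\<dots> = (\<Sum>k=1..n. c n k + 1 / real (Suc n) * (D ^ k / real (Suc n - k)))"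
  proof (rule sum.cong)
    fix k assume k: "k \<in> {1..n}"
    have h: "harm (Suc n - k) = harm (n - k) + 1 / real (Suc n - k)"
      using k by (simp add: Suc_diff_le harm_Suc inverse_eq_divide)
    have r: "real (Suc n - k) = real (Suc n) - real k" "real (Suc n) - real k > 0"
      using k by (auto simp: of_nat_diff)
    have "1 / (real (Suc n) - real k) - 1 / real (Suc n) =
        real k / (real (Suc n) * (real (Suc n) - real k))"
      using r(2) by (simp add: field_simps)
    hence num: "(harm k + harm (Suc n - k) - harm (Suc n) :: real) =
        harm k + harm (n - k) - harm n + real k / (real (Suc n) * (real (Suc n) - real k))"
      unfolding h harm_Suc r(1) by (simp add: inverse_eq_divide)
    show "c (Suc n) k = c n k + 1 / real (Suc n) * (D ^ k / real (Suc n - k))"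
      unfolding c_def num r(1) using k
      by (simp add: add_divide_distrib distrib_right del: of_nat_Suc)
  qed simp
  also have "\<dots> = (\<Sum>k=1..n. c n k) + 1 / real (Suc n) * (\<Sum>k=1..n. D ^ k / real (Suc n - k))"
    by (simp add: sum.distrib sum_distrib_left del: of_nat_Suc)
  finally have c: "(\<Sum>k=1..Suc n. c (Suc n) k) = \<dots>" .
  have "(\<Sum>k<Suc n. D ^ k / real (Suc n - k)) =
      1 / real (Suc n) + (\<Sum>k=1..n. D ^ k / real (Suc n - k))"
    by (subst lessThan_Suc_atMost, subst atMost_atLeast0, subst sum.atLeast_Suc_atMost) auto
  moreover have "harm2 (Suc n) = harm2 n + 1 / real (Suc n) * (1 / real (Suc n))"
    unfolding harm2_def by (simp add: power2_eq_square)
  moreover have "(\<Sum>k=1..Suc n. 1 / real k * D ^ k) =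
      (\<Sum>k=1..n. 1 / real k * D ^ k) + 1 / real (Suc n) * D ^ Suc n"
    by simp
  moreover have "closed_form m t = Li2 t - harm2 m
      + ln (1 - t) * (\<Sum>k=1..m. 1 / real k * D ^ k) - (\<Sum>k=1..m. c m k)" for m
    unfolding closed_form_def c_def D_def ..
  ultimately show ?thesis
    using c by (simp only: ring_distribs) (simp add: algebra_simps del: of_nat_Suc)
qed

text \<open>A majorant independent of \<open>t\<close>: it yields convergence on all of \<open>[-1, 1]\<close> and, by the
  Weierstrass test, continuity up to the endpoints.\<close>

lemma reciprocal_binomial_term_bound:
  fixes t :: real
  assumes "\<bar>t\<bar> \<le> 1"
  shows "norm (t ^ Suc k / (real (Suc k) ^ 2 * real ((n + Suc k) choose Suc k)))
           \<le> 1 / real (Suc k) ^ 2"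
proof -
  have "(n + Suc k) choose Suc k \<noteq> 0" by simp
  hence "1 \<le> real ((n + Suc k) choose Suc k)"
    by linarith
  hence "real (Suc k) ^ 2 * 1 \<le> real (Suc k) ^ 2 * real ((n + Suc k) choose Suc k)"
    by (intro mult_left_mono) auto
  moreover have "\<bar>t ^ Suc k\<bar> \<le> 1"
    using assms unfolding power_abs by (intro power_le_one) auto
  ultimately have "\<bar>t ^ Suc k\<bar> / (real (Suc k) ^ 2 * real ((n + Suc k) choose Suc k))
      \<le> 1 / real (Suc k) ^ 2"
    by (intro frac_le) auto
  then show ?thesis by (simp add: abs_mult del: of_nat_Suc binomial_Suc_Suc power_Suc)
qed

lemma summable_inverse_squares_Suc: "summable (\<lambda>k. 1 / real (Suc k) ^ 2)"
  using inverse_power_summable[of 2, where 'a = real]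
  by (subst summable_Suc_iff) (simp add: inverse_eq_divide)

lemma sums_closed_form:
  fixes t :: real
  assumes t: "-1 \<le> t" "t < 1" "t \<noteq> 0"
  shows "(\<lambda>k. t ^ Suc k / (real (Suc k) ^ 2 * real ((n + Suc k) choose Suc k))) sums
           closed_form n t"
proof (induction n)
  case 0
  have "summable (\<lambda>k. t ^ Suc k / (real (Suc k) ^ 2 * real ((0 + Suc k) choose Suc k)))"
    using t by (intro summable_comparison_test'[OF summable_inverse_squares_Suc]
        reciprocal_binomial_term_bound) auto
  from summable_sums[OF this] show ?case
    by (simp add: closed_form_def Li2_def harm2_def)
next
  case (Suc n)
  have *: "t ^ Suc k / (real (Suc k) ^ 2 * real ((n + Suc k) choose Suc k))
      - 1 / real (Suc n) * (t ^ Suc k / (real (Suc k) * real ((Suc n + Suc k) choose Suc k)))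
      = t ^ Suc k / (real (Suc k) ^ 2 * real ((Suc n + Suc k) choose Suc k))" for k
    using arg_cong[OF reciprocal_binomial_step_square[of k n], of "\<lambda>x. t ^ Suc k * x"]
    by (simp add: right_diff_distrib del: of_nat_Suc binomial_Suc_Suc power_Suc)
  show ?case
    using sums_diff[OF Suc sums_mult[OF first_order_sums[OF t, of "Suc n"], of "1 / real (Suc n)"]]
    unfolding * closed_form_Suc .
qed

section \<open>Continuity and the endpoint\<close>

lemma continuous_on_reciprocal_binomial_series:
  "continuous_on {-1..1::real}
     (\<lambda>t. \<Sum>k. t ^ Suc k / (real (Suc k) ^ 2 * real ((n + Suc k) choose Suc k)))"
proof (rule uniform_limit_theorem)
  show "uniform_limit {-1..1::real}
      (\<lambda>m t. \<Sum>k<m. t ^ Suc k / (real (Suc k) ^ 2 * real ((n + Suc k) choose Suc k)))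
      (\<lambda>t. \<Sum>k. t ^ Suc k / (real (Suc k) ^ 2 * real ((n + Suc k) choose Suc k))) sequentially"
    by (intro Weierstrass_m_test[OF _ summable_inverse_squares_Suc]
        reciprocal_binomial_term_bound) auto
  show "\<forall>\<^sub>F m in sequentially. continuous_on {-1..1::real}
      (\<lambda>t. \<Sum>k<m. t ^ Suc k / (real (Suc k) ^ 2 * real ((n + Suc k) choose Suc k)))"
    by (intro always_eventually allI continuous_intros)
       (auto simp del: of_nat_Suc binomial_Suc_Suc)
qed simp

theorem theorem2p17:
  fixes n :: nat and t :: real
  assumes "n \<ge> 1" and "\<bar>t\<bar> \<le> 1" and "t \<noteq> 0"
  shows "\<exists>R. (if t = 1 then (closed_form n \<longlongrightarrow> R) (at_left 1) else R = closed_form n t)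
           \<and> (\<lambda>k. t ^ Suc k / (real (Suc k) ^ 2 * real ((n + Suc k) choose Suc k))) sums R"
proof (cases "t = 1")
  case False
  then show ?thesis
    using assms sums_closed_form[of t n] by auto
next
  case True
  define S where
    "S = (\<lambda>t::real. \<Sum>k. t ^ Suc k / (real (Suc k) ^ 2 * real ((n + Suc k) choose Suc k)))"
  have "summable (\<lambda>k. t ^ Suc k / (real (Suc k) ^ 2 * real ((n + Suc k) choose Suc k)))"
    using assms by (intro summable_comparison_test'[OF summable_inverse_squares_Suc]
        reciprocal_binomial_term_bound) auto
  hence sums: "(\<lambda>k. t ^ Suc k / (real (Suc k) ^ 2 * real ((n + Suc k) choose Suc k))) sums S 1"
    unfolding S_def True by (rule summable_sums)
  have "continuous_on {-1..1} S"
    unfolding S_def by (rule continuous_on_reciprocal_binomial_series)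
  hence "(S \<longlongrightarrow> S 1) (at 1 within {-1..1})"
    unfolding continuous_on_def by auto
  hence lim: "(S \<longlongrightarrow> S 1) (at_left 1)"
    by (simp add: at_within_Icc_at_left)
  have "\<forall>\<^sub>F x in at_left (1::real). x \<in> {0<..<1}"
    by (intro eventually_at_leftI[of 0]) auto
  hence "\<forall>\<^sub>F x in at_left 1. S x = closed_form n x"
    unfolding S_def by eventually_elim (rule sums_unique[symmetric], rule sums_closed_form, auto)
  hence "(closed_form n \<longlongrightarrow> S 1) (at_left 1)"
    using lim by (rule Lim_transform_eventually[rotated])
  then show ?thesis using sums True by auto
qed

end
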